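(* Let $a \in \mathbb{N}=\{0,1,2,\dots\}$ and let $s \in \mathbb{C}$ with $\operatorname{Re}(s) > a+2$. Then for every real $x \geq 0$, $$ \sum_{k \geq 1} (-1)^k (k + x)^a\,\zeta(s, k + x) = - \frac{1}{2}E_a(x+1)\,\zeta(s,x+1) - \sum_{j=0}^{a} \sum_{\ell = 0}^{a-j} \frac{E_j}{2^{a-\ell + 1}}\binom{a}{j} \binom{a - j}{\ell}\, L\!\left(\tfrac12, s - \ell, x+1\right). $$
   Context: $\zeta(s,x) = \sum_{n\ge 0} (n+x)^{-s}$ denotes the Hurwitz zeta function. $L(\lambda,s,x) = \sum_{n \geq 0} \exp(2\pi i \lambda n)\,(n + x)^{-s}$ denotes the Lerch zeta function; in particular $L(\tfrac12,s,x)=\sum_{n\ge0}(-1)^n (n+x)^{-s}$. $E_n(x)$ denotes the $n$th Euler polynomial (generating function $2e^{xt}/(e^t+1)=\sum_n E_n(x)t^n/n!$), and $E_n$ the $n$th Euler number, $E_n = 2^n E_n(\tfrac12)$ (so $E_0=1$, $E_1=0$, $E_2=-1$, $\dots$). *)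

theory Defs
  imports "HOL-Analysis.Analysis" "HOL-Computational_Algebra.Formal_Power_Series"
begin

text \<open>
  The two zeta functions are given by their Dirichlet series, hence are only meaningful where these
  converge (no analytic continuation), and for \<^term>\<open>x > (0::real)\<close>.
\<close>

definition hurwitz_zeta :: "complex \<Rightarrow> real \<Rightarrow> complex" where
  "hurwitz_zeta s x = (\<Sum>n. of_real (real n + x) powr (- s))"

definition lerch_zeta :: "real \<Rightarrow> complex \<Rightarrow> real \<Rightarrow> complex" where
  "lerch_zeta l s x =
     (\<Sum>n. exp (2 * of_real pi * \<i> * of_real l * of_nat n) * of_real (real n + x) powr (- s))"

text \<open>
  \<open>euler_poly n x\<close> is the value at \<open>x\<close> of the \<open>n\<close>-th Euler polynomial, read off from the generating
  function \<open>2 e\<^sup>x\<^sup>t / (e\<^sup>t + 1)\<close> as a formal power series in \<open>t\<close>.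
\<close>

definition euler_poly :: "nat \<Rightarrow> real \<Rightarrow> real" where
  "euler_poly n x = fact n * fps_nth (2 * fps_exp x / (fps_exp 1 + 1)) n"

definition euler_number :: "nat \<Rightarrow> real" where
  "euler_number n = 2 ^ n * euler_poly n (1 / 2)"

end

theory Submission
  imports Defs
begin

text \<open>
  Put \<open>y = x + 1\<close> and let \<open>A\<^sub>K\<close> be the sum of \<open>(-1)\<^sup>k (k + y)\<^sup>a\<close> over \<open>k < K\<close>. Since
  \<open>\<zeta>(s, k + y) - \<zeta>(s, k + 1 + y) = (k + y)\<^sup>-\<^sup>s\<close>, Abel summation turns the series into the sum of
  \<open>A\<^bsub>m+1\<^esub> (m + y)\<^sup>-\<^sup>s\<close>. Since \<open>(k + y)\<^sup>a\<close> is nonnegative and increases with \<open>k\<close>, the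
  alternating sum satisfies \<open>\<bar>A\<^sub>K\<bar> \<le> (K + y)\<^sup>a\<close>, so the boundary term \<open>A\<^sub>K \<zeta>(s, K + y)\<close> is
  dominated by a tail of the convergent series of \<open>(m + y)\<^bsup>a - Re s\<^esup>\<close>. The functional
  equation \<open>E\<^sub>a(y + 1) + E\<^sub>a(y) = 2 y\<^sup>a\<close> gives
  \<open>A\<^bsub>m+1\<^esub> = (E\<^sub>a(y) + (-1)\<^sup>m E\<^sub>a(m + y + 1)) / 2\<close>. Expanding \<open>E\<^sub>a\<close> around \<open>1\<close> then yields
  the Lerch values, with coefficients \<open>E\<^sub>n(1)\<close> that are in turn expanded around \<open>1/2\<close>.
\<close>

definition euler_fps :: "real \<Rightarrow> real fps" where
  "euler_fps x = 2 * fps_exp x / (fps_exp 1 + 1)"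

lemma euler_poly_conv_euler_fps: "euler_poly n x = fact n * fps_nth (euler_fps x) n"
  by (simp add: euler_poly_def euler_fps_def)

lemma euler_fps_add: "euler_fps (x + h) = fps_exp h * euler_fps x"
  by (simp add: euler_fps_def fps_divide_unit fps_exp_add_mult mult_ac)

lemma euler_fps_plus_1: "euler_fps (x + 1) + euler_fps x = 2 * fps_exp x"
proof -
  have "euler_fps (x + 1) + euler_fps x = (2 * fps_exp x / (fps_exp 1 + 1)) * (fps_exp 1 + 1)"
    unfolding euler_fps_add by (simp add: euler_fps_def algebra_simps)
  also have "\<dots> = 2 * fps_exp x"
    by (simp add: fps_divide_unit mult.assoc inverse_mult_eq_1)
  finally show ?thesis .
qed

lemma euler_poly_plus_1: "euler_poly n (x + 1) + euler_poly n x = 2 * x ^ n"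
proof -
  have "euler_poly n (x + 1) + euler_poly n x
          = fact n * fps_nth (euler_fps (x + 1) + euler_fps x) n"
    by (simp add: euler_poly_conv_euler_fps distrib_left)
  also have "\<dots> = 2 * x ^ n"
    unfolding euler_fps_plus_1 by (simp add: numeral_fps_const)
  finally show ?thesis .
qed

lemma euler_poly_add:
  "euler_poly n (x + h) = (\<Sum>l=0..n. of_nat (n choose l) * euler_poly (n - l) x * h ^ l)"
proof -
  have "euler_poly n (x + h)
          = (\<Sum>l=0..n. fact n * (h ^ l / fact l * fps_nth (euler_fps x) (n - l)))"
    by (simp add: euler_poly_conv_euler_fps euler_fps_add fps_mult_nth sum_distrib_left)
  also have "\<dots> = (\<Sum>l=0..n. of_nat (n choose l) * euler_poly (n - l) x * h ^ l)"
    by (rule sum.cong) (auto simp: euler_poly_conv_euler_fps binomial_fact field_simps)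
  finally show ?thesis .
qed

lemma euler_poly_1_conv_euler_number:
  "euler_poly n 1 = (\<Sum>j=0..n. of_nat (n choose j) * euler_number j) / 2 ^ n"
proof -
  have "euler_poly n 1 = (\<Sum>l=0..n. of_nat (n choose l) * euler_poly (n - l) (1 / 2) * (1 / 2) ^ l)"
    using euler_poly_add[of n "1 / 2" "1 / 2"] by simp
  also have "\<dots> = (\<Sum>l=0..n. of_nat (n choose (n - l)) * euler_number (n - l) / 2 ^ n)"
    by (intro sum.cong)
       (auto simp: euler_number_def power_diff power_one_over simp flip: binomial_symmetric)
  also have "\<dots> = (\<Sum>j=0..n. of_nat (n choose j) * euler_number j / 2 ^ n)"
    by (subst (2) sum.atLeastAtMost_rev) simp
  finally show ?thesis
    by (simp add: sum_divide_distrib)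
qed

lemma choose_mult_choose_commute:
  assumes "j + l \<le> n"
  shows "(n choose l) * ((n - l) choose j) = (n choose j) * ((n - j) choose l)"
proof -
  have "(n choose l) * ((n - l) choose j) = (n choose (j + l)) * ((j + l) choose l)"
    using choose_mult[of l "j + l" n] assms by simp
  also have "(j + l) choose l = (j + l) choose j"
    using binomial_symmetric[of l "j + l"] by simp
  also have "(n choose (j + l)) * ((j + l) choose j) = (n choose j) * ((n - j) choose l)"
    using choose_mult[of j "j + l" n] assms by simp
  finally show ?thesis .
qed

lemma sum_euler_poly_1_conv_euler_number:
  fixes f :: "nat \<Rightarrow> 'a :: real_field"
  shows "(\<Sum>l=0..a. of_nat (a choose l) * of_real (euler_poly (a - l) 1) * f l)
    = (\<Sum>j=0..a. \<Sum>l=0..a - j.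
         of_real (euler_number j) / 2 ^ (a - l) * of_nat (a choose j) * of_nat ((a - j) choose l) * f l)"
    (is "_ = (\<Sum>j=0..a. \<Sum>l=0..a - j. ?g j l)")
proof -
  have "of_nat (a choose l) * of_real (euler_poly (a - l) 1) * f l = (\<Sum>j=0..a - l. ?g j l)"
    if "l \<le> a" for l
  proof -
    have "of_nat (a choose l) * of_real (euler_poly (a - l) 1) * f l
        = (\<Sum>j=0..a - l. of_nat ((a choose l) * ((a - l) choose j))
             * of_real (euler_number j) / 2 ^ (a - l) * f l)"
      by (simp add: euler_poly_1_conv_euler_number sum_distrib_left sum_distrib_right
            sum_divide_distrib mult_ac)
    also have "\<dots> = (\<Sum>j=0..a - l. ?g j l)"
      using that by (intro sum.cong refl, subst choose_mult_choose_commute) (auto simp: mult_ac)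
    finally show ?thesis .
  qed
  then have "(\<Sum>l=0..a. of_nat (a choose l) * of_real (euler_poly (a - l) 1) * f l)
               = (\<Sum>l=0..a. \<Sum>j=0..a - l. ?g j l)"
    by simp
  also have "\<dots> = (\<Sum>j=0..a. \<Sum>l=0..a - j. ?g j l)"
    unfolding sum.Sigma[OF finite_atLeastAtMost ballI[OF finite_atLeastAtMost]]
    by (rule sum.reindex_bij_witness[of _ prod.swap prod.swap]) auto
  finally show ?thesis .
qed

lemma alternating_power_sum:
  "(\<Sum>k\<le>m. (-1) ^ k * (real k + y) ^ a)
     = (euler_poly a y + (-1) ^ m * euler_poly a (real m + y + 1)) / 2"
proof (induction m)
  case 0
  then show ?case using euler_poly_plus_1[of a y] by simp
next
  case (Suc m)
  have "(-1) ^ m * (real m + y + 1) ^ a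
          = (-1) ^ m * (euler_poly a (real m + y + 1 + 1) + euler_poly a (real m + y + 1)) / 2"
    using euler_poly_plus_1[of a "real m + y + 1"] by simp
  with Suc show ?case by (simp add: field_simps)
qed

lemma abs_alternating_sum_le:
  fixes f :: "nat \<Rightarrow> 'a :: linordered_idom"
  assumes "incseq f" "f 0 \<ge> 0"
  shows "\<bar>\<Sum>k<n. (-1) ^ k * f k\<bar> \<le> f n"
proof -
  have "0 \<le> (-1) ^ Suc n * (\<Sum>k<n. (-1) ^ k * f k)
      \<and> (-1) ^ Suc n * (\<Sum>k<n. (-1) ^ k * f k) \<le> f n"
  proof (induction n)
    case 0
    then show ?case using assms by simp
  next
    case (Suc n)
    have "(-1) ^ Suc (Suc n) * (\<Sum>k<Suc n. (-1) ^ k * f k)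
            = f n - (-1) ^ Suc n * (\<Sum>k<n. (-1) ^ k * f k)"
      by (simp add: distrib_left)
    with Suc incseq_SucD[OF assms(1), of n] show ?case by linarith
  qed
  then have "\<bar>(-1) ^ Suc n * (\<Sum>k<n. (-1) ^ k * f k)\<bar> \<le> f n"
    by simp
  then show ?thesis
    by (simp add: abs_mult)
qed

lemma sums_by_parts:
  fixes c d :: "nat \<Rightarrow> 'a :: real_normed_algebra"
  assumes "(\<lambda>m. (\<Sum>k\<le>m. c k) * (d m - d (Suc m))) sums S"
    and "(\<lambda>n. (\<Sum>k<n. c k) * d n) \<longlonglongrightarrow> B"
  shows "(\<lambda>k. c k * d k) sums (S + B)"
proof -
  have "(\<Sum>k<n. c k * d k)
          = (\<Sum>m<n. (\<Sum>k\<le>m. c k) * (d m - d (Suc m))) + (\<Sum>k<n. c k) * d n" for n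
    by (induction n) (simp_all add: algebra_simps flip: lessThan_Suc_atMost)
  then show ?thesis
    using tendsto_add[OF assms(1)[unfolded sums_def] assms(2)] by (simp add: sums_def)
qed

lemma summable_shifted_powr:
  fixes y p :: real
  assumes "y \<ge> 0" "p < -1"
  shows "summable (\<lambda>n. (real n + y) powr p)"
proof (rule summable_comparison_test)
  show "summable (\<lambda>n. real n powr p)"
    using assms by (simp add: summable_real_powr_iff)
  have "(real n + y) powr p \<le> real n powr p" if "n \<ge> 1" for n
    using assms that by (intro powr_mono2') auto
  then show "\<exists>N. \<forall>n\<ge>N. norm ((real n + y) powr p) \<le> real n powr p"
    by auto
qed

lemma lerch_zeta_sums:
  assumes "y \<ge> 0" "Re s > 1"
  shows "(\<lambda>n. exp (2 * of_real pi * \<i> * of_real l * of_nat n) * of_real (real n + y) powr (- s))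
    sums lerch_zeta l s y"
proof -
  have "norm (exp (2 * of_real pi * \<i> * of_real l * of_nat n) * of_real (real n + y) powr (- s))
          = (real n + y) powr (- Re s)" for n
    using assms by (simp add: norm_mult norm_powr_real_powr)
  then have "summable (\<lambda>n. norm (exp (2 * of_real pi * \<i> * of_real l * of_nat n)
      * of_real (real n + y) powr (- s)))"
    using assms by (simp only:) (auto intro: summable_shifted_powr)
  then show ?thesis
    unfolding lerch_zeta_def by (rule summable_sums[OF summable_norm_cancel])
qed

lemma lerch_zeta_half_sums:
  assumes "y \<ge> 0" "Re s > 1"
  shows "(\<lambda>n. (-1) ^ n * of_real (real n + y) powr (- s)) sums lerch_zeta (1 / 2) s y"
proof -
  have "exp (2 * of_real pi * \<i> * of_real (1 / 2) * of_nat n) = (-1) ^ n" for n :: nat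
    using exp_of_nat_mult[of n "\<i> * of_real pi"] by (simp add: mult_ac)
  then show ?thesis
    using lerch_zeta_sums[OF assms, of "1 / 2"] by (simp only:)
qed

lemma of_real_power_mult_powr:
  assumes "r > 0"
  shows "of_real r ^ l * of_real r powr (- s) = complex_of_real r powr (- (s - of_nat l))"
proof -
  have "complex_of_real r powr (of_nat l + - s) = of_real r ^ l * of_real r powr (- s)"
    unfolding powr_add using assms by (simp add: powr_nat')
  then show ?thesis by simp
qed

definition euler_lerch_sum :: "nat \<Rightarrow> complex \<Rightarrow> real \<Rightarrow> complex" where
  "euler_lerch_sum a s y = (\<Sum>l=0..a.
     of_nat (a choose l) * of_real (euler_poly (a - l) 1) * lerch_zeta (1 / 2) (s - of_nat l) y)"

lemma alternating_euler_poly_sums: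
  assumes "y > 0" "Re s > real a + 1"
  shows "(\<lambda>m. (-1) ^ m * of_real (euler_poly a (real m + y + 1)) * of_real (real m + y) powr (- s))
    sums euler_lerch_sum a s y"
proof -
  have "(\<lambda>m. \<Sum>l=0..a. of_nat (a choose l) * of_real (euler_poly (a - l) 1)
            * ((-1) ^ m * of_real (real m + y) powr (- (s - of_nat l))))
    sums euler_lerch_sum a s y"
    unfolding euler_lerch_sum_def using assms
    by (intro sums_sum sums_mult lerch_zeta_half_sums) auto
  moreover have "(\<Sum>l=0..a. of_nat (a choose l) * of_real (euler_poly (a - l) 1)
            * ((-1) ^ m * of_real (real m + y) powr (- (s - of_nat l))))
      = (-1) ^ m * of_real (euler_poly a (real m + y + 1)) * of_real (real m + y) powr (- s)" for m
  proof -
    have pos: "real m + y > 0"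
      using assms by simp
    show ?thesis
      unfolding add.commute[of _ 1] euler_poly_add of_real_power_mult_powr[OF pos, symmetric]
      by (simp add: sum_distrib_left sum_distrib_right mult_ac)
  qed
  ultimately show ?thesis by simp
qed

lemma hurwitz_zeta_sums:
  assumes "y \<ge> 0" "Re s > 1"
  shows "(\<lambda>n. of_real (real n + y) powr (- s)) sums hurwitz_zeta s y"
  using lerch_zeta_sums[OF assms, of 0] by (simp add: hurwitz_zeta_def lerch_zeta_def)

lemma hurwitz_zeta_plus_1:
  assumes "y \<ge> 0" "Re s > 1"
  shows "hurwitz_zeta s (y + 1) = hurwitz_zeta s y - of_real y powr (- s)"
proof -
  have "(\<lambda>n. of_real (real (Suc n) + y) powr (- s)) sums (hurwitz_zeta s y - of_real y powr (- s))"
    using hurwitz_zeta_sums[OF assms] by (subst sums_Suc_iff) simp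
  moreover have "(\<lambda>n. of_real (real (Suc n) + y) powr (- s)) sums hurwitz_zeta s (y + 1)"
    using hurwitz_zeta_sums[of "y + 1" s] assms by (simp add: add_ac)
  ultimately show ?thesis
    by (rule sums_unique2[symmetric])
qed

lemma norm_hurwitz_zeta_le:
  assumes "y \<ge> 0" "Re s > 1"
  shows "norm (hurwitz_zeta s y) \<le> (\<Sum>n. (real n + y) powr (- Re s))"
proof -
  have "norm (complex_of_real (real n + y) powr (- s)) = (real n + y) powr (- Re s)" for n
    using assms by (simp add: norm_powr_real_powr)
  then show ?thesis
    unfolding hurwitz_zeta_def
    using summable_norm[of "\<lambda>n. complex_of_real (real n + y) powr (- s)"]
      summable_shifted_powr[of y "- Re s"] assms
    by simp
qed

lemma power_mult_norm_hurwitz_zeta_le: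
  assumes "y > 0" "Re s > real a + 1"
  shows "y ^ a * norm (hurwitz_zeta s y) \<le> (\<Sum>n. (real n + y) powr (real a - Re s))"
proof -
  have summable_powr: "summable (\<lambda>n. (real n + y) powr (- Re s))"
    using assms by (intro summable_shifted_powr) auto
  have "y ^ a * norm (hurwitz_zeta s y) \<le> y ^ a * (\<Sum>n. (real n + y) powr (- Re s))"
    using assms by (intro mult_left_mono norm_hurwitz_zeta_le) auto
  also have "\<dots> = (\<Sum>n. y ^ a * (real n + y) powr (- Re s))"
    using summable_powr by (rule suminf_mult[symmetric])
  also have "\<dots> \<le> (\<Sum>n. (real n + y) powr (real a - Re s))"
  proof (rule suminf_le)
    fix n
    have "y ^ a * (real n + y) powr (- Re s) \<le> (real n + y) ^ a * (real n + y) powr (- Re s)"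
      using assms by (intro mult_right_mono power_mono) auto
    also have "\<dots> = (real n + y) powr (real a - Re s)"
      using assms by (simp add: powr_diff powr_minus powr_realpow divide_inverse)
    finally show "y ^ a * (real n + y) powr (- Re s) \<le> (real n + y) powr (real a - Re s)" .
  qed (use assms summable_powr in \<open>auto intro: summable_mult summable_shifted_powr\<close>)
  finally show ?thesis .
qed

lemma power_mult_norm_hurwitz_zeta_tendsto_0:
  assumes "y > 0" "Re s > real a + 1"
  shows "(\<lambda>n. (real n + y) ^ a * norm (hurwitz_zeta s (real n + y))) \<longlonglongrightarrow> 0"
proof (rule Lim_null_comparison)
  have "summable (\<lambda>n. (real n + y) powr (real a - Re s))"
    using assms by (intro summable_shifted_powr) auto
  then show "(\<lambda>n. \<Sum>k. (real k + (real n + y)) powr (real a - Re s)) \<longlonglongrightarrow> 0"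
    using suminf_exist_split2[of "\<lambda>n. (real n + y) powr (real a - Re s)"] by (simp add: add.assoc)
  have "(real n + y) ^ a * norm (hurwitz_zeta s (real n + y))
          \<le> (\<Sum>k. (real k + (real n + y)) powr (real a - Re s))" for n
    using assms by (intro power_mult_norm_hurwitz_zeta_le) auto
  then show "\<forall>\<^sub>F n in sequentially. norm ((real n + y) ^ a * norm (hurwitz_zeta s (real n + y)))
          \<le> (\<Sum>k. (real k + (real n + y)) powr (real a - Re s))"
    using assms by (simp add: abs_mult)
qed

lemma alternating_power_sum_mult_hurwitz_zeta_tendsto_0:
  assumes "y > 0" "Re s > real a + 1"
  shows "(\<lambda>n. of_real (\<Sum>k<n. (-1) ^ k * (real k + y) ^ a) * hurwitz_zeta s (real n + y)) \<longlonglongrightarrow> 0"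
proof (rule Lim_null_comparison)
  have "incseq (\<lambda>k. (real k + y) ^ a)"
    using assms by (intro incseq_SucI power_mono) auto
  then have "\<bar>\<Sum>k<n. (-1) ^ k * (real k + y) ^ a\<bar> \<le> (real n + y) ^ a" for n
    using assms by (intro abs_alternating_sum_le) auto
  then show "\<forall>\<^sub>F n in sequentially.
      norm (of_real (\<Sum>k<n. (-1) ^ k * (real k + y) ^ a) * hurwitz_zeta s (real n + y))
        \<le> (real n + y) ^ a * norm (hurwitz_zeta s (real n + y))"
    unfolding norm_mult norm_of_real by (intro always_eventually allI mult_right_mono) auto
qed (rule power_mult_norm_hurwitz_zeta_tendsto_0[OF assms])

lemma hurwitz_zeta_sums_by_parts:
  assumes "y \<ge> 0" "Re s > 1"
    and "(\<lambda>m. (\<Sum>k\<le>m. c k) * of_real (real m + y) powr (- s)) sums S"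
    and "(\<lambda>n. (\<Sum>k<n. c k) * hurwitz_zeta s (real n + y)) \<longlonglongrightarrow> B"
  shows "(\<lambda>k. c k * hurwitz_zeta s (real k + y)) sums (S + B)"
proof (rule sums_by_parts)
  have "hurwitz_zeta s (real m + y) - hurwitz_zeta s (real (Suc m) + y)
          = of_real (real m + y) powr (- s)" for m
    using hurwitz_zeta_plus_1[of "real m + y" s] assms(1,2) by (simp add: add_ac)
  then show "(\<lambda>m. (\<Sum>k\<le>m. c k)
      * (hurwitz_zeta s (real m + y) - hurwitz_zeta s (real (Suc m) + y))) sums S"
    using assms(3) by simp
qed (rule assms(4))

lemma alternating_power_mult_hurwitz_zeta_sums:
  assumes "y > 0" "Re s > real a + 1"
  shows "(\<lambda>k. (-1) ^ k * of_real (real k + y) ^ a * hurwitz_zeta s (real k + y)) sums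
    ((of_real (euler_poly a y) * hurwitz_zeta s y + euler_lerch_sum a s y) / 2)"
    (is "_ sums ?S")
proof -
  have "(\<lambda>m. (of_real (euler_poly a y) * of_real (real m + y) powr (- s)
          + (-1) ^ m * of_real (euler_poly a (real m + y + 1)) * of_real (real m + y) powr (- s)) / 2)
        sums ?S"
    using assms
    by (intro sums_divide sums_add sums_mult hurwitz_zeta_sums alternating_euler_poly_sums) auto
  moreover have "(\<Sum>k\<le>m. (-1) ^ k * complex_of_real (real k + y) ^ a)
      = (of_real (euler_poly a y) + (-1) ^ m * of_real (euler_poly a (real m + y + 1))) / 2" for m
    using arg_cong[OF alternating_power_sum, of complex_of_real y a m] by simp
  ultimately have "(\<lambda>m. (\<Sum>k\<le>m. (-1) ^ k * of_real (real k + y) ^ a)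
      * of_real (real m + y) powr (- s)) sums ?S"
    by (simp only: distrib_right times_divide_eq_left)
  moreover have "(\<lambda>n. (\<Sum>k<n. (-1) ^ k * of_real (real k + y) ^ a) * hurwitz_zeta s (real n + y))
      \<longlonglongrightarrow> 0"
    using alternating_power_sum_mult_hurwitz_zeta_tendsto_0[OF assms] by simp
  ultimately show ?thesis
    using hurwitz_zeta_sums_by_parts[of y s _ ?S 0] assms by simp
qed

theorem theorem1p8:
  fixes a :: nat and s :: complex and x :: real
  assumes "Re s > real a + 2" and "x \<ge> 0"
  shows "(\<lambda>k. (-1) ^ (k + 1) * of_real (real (k + 1) + x) ^ a * hurwitz_zeta s (real (k + 1) + x))
    sums
      (- (1 / 2) * of_real (euler_poly a (x + 1)) * hurwitz_zeta s (x + 1)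
       - (\<Sum>j=0..a. \<Sum>l=0..a - j.
            of_real (euler_number j) / 2 ^ (a - l + 1) * of_nat (a choose j) * of_nat ((a - j) choose l)
            * lerch_zeta (1 / 2) (s - of_nat l) (x + 1)))"
proof -
  have summand: "(-1) ^ (k + 1) * of_real (real (k + 1) + x) ^ a * hurwitz_zeta s (real (k + 1) + x)
      = - ((-1) ^ k * of_real (real k + (x + 1)) ^ a * hurwitz_zeta s (real k + (x + 1)))" for k
    by (simp add: add_ac)
  have lerch_sum: "(\<Sum>j=0..a. \<Sum>l=0..a - j.
      of_real (euler_number j) / 2 ^ (a - l + 1) * of_nat (a choose j) * of_nat ((a - j) choose l)
      * lerch_zeta (1 / 2) (s - of_nat l) (x + 1)) = euler_lerch_sum a s (x + 1) / 2"
    unfolding euler_lerch_sum_def sum_euler_poly_1_conv_euler_number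
    by (simp add: sum_divide_distrib mult_ac)
  have "(\<lambda>k. - ((-1) ^ k * of_real (real k + (x + 1)) ^ a * hurwitz_zeta s (real k + (x + 1))))
      sums - ((of_real (euler_poly a (x + 1)) * hurwitz_zeta s (x + 1)
              + euler_lerch_sum a s (x + 1)) / 2)"
    using assms by (intro sums_minus alternating_power_mult_hurwitz_zeta_sums) auto
  then show ?thesis
    unfolding summand lerch_sum by (simp add: add_divide_distrib)
qed

end
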